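(* Let $A\cdot x=y$ be a right system of linear equations with matrix of coefficients $A\in \mathrm{M}(n,\mathbf{H})$, column of constants $y=(y_1,\ldots,y_n)^T\in\mathbf{H}^{n\times 1}$ and column of unknowns $x=(x_1,\ldots,x_n)^T$. If $A$ is Hermitian and $\det A\neq 0$, then the unique solution vector $x$ of the system is given by $$x_j=\frac{\mathrm{cdet}_j\,A_{.j}(y)}{\det A},\qquad j=1,\ldots,n.$$
   Context: $\mathbf{H}$ is the skew field of real quaternions; $\mathrm{M}(n,\mathbf{H})$ is the ring of $n\times n$ matrices over $\mathbf{H}$; a matrix $A$ is Hermitian if it equals its conjugate transpose $A^*$. Column determinants: for $A=(a_{pq})\in \mathrm{M}(n,\mathbf{H})$ and $j\in\{1,\ldots,n\}$, $$\mathrm{cdet}_j A=\sum_{\tau\in S_n}(-1)^{n-r}a_{j_{k_r}j_{k_r+l_r}}\cdots a_{j_{k_r+1}j_{k_r}}\cdots a_{j\,j_{k_1+l_1}}\cdots a_{j_{k_1+1}j_{k_1}}a_{j_{k_1}j},$$ where each $\tau\in S_n$ is written as a product of its $r$ disjoint cycles (fixed points included) $\tau=(j_{k_r+l_r}\ldots j_{k_r+1}j_{k_r})\ldots(j_{k_2+l_2}\ldots j_{k_2+1}j_{k_2})(j_{k_1+l_1}\ldots j_{k_1+1}j_{k_1}j)$, each entry of a cycle being mapped to the next; the rightmost cycle ends with $j$, every other cycle has its smallest element in the rightmost position, and $j_{k_2}<j_{k_3}<\cdots<j_{k_r}$. A fixed point $p$ contributes the factor $a_{pp}$. For Hermitian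 $A\in \mathrm{M}(n,\mathbf{H})$ all column determinants $\mathrm{cdet}_jA$ coincide and are real; the common value is denoted $\det A$. $A_{.j}(v)$ denotes the matrix obtained from $A$ by replacing its $j$th column with the column $v$. *)

theory Defs
  imports "HOL-Analysis.Analysis" "HOL-Combinatorics.Combinatorics"
begin

section \<open>Quaternions\<close>

text \<open>\<open>Quat a b c d\<close> is the quaternion \<open>a + b i + c j + d k\<close>.\<close>

datatype quat = Quat (qre: real) (qim1: real) (qim2: real) (qim3: real)

lemma quat_eq_iff:
  "p = q \<longleftrightarrow> qre p = qre q \<and> qim1 p = qim1 q \<and> qim2 p = qim2 q \<and> qim3 p = qim3 q"
  by (cases p; cases q) auto

definition qcnj :: "quat \<Rightarrow> quat" where
  "qcnj q = Quat (qre q) (- qim1 q) (- qim2 q) (- qim3 q)"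

definition qnorm2 :: "quat \<Rightarrow> real" where
  "qnorm2 q = (qre q)\<^sup>2 + (qim1 q)\<^sup>2 + (qim2 q)\<^sup>2 + (qim3 q)\<^sup>2"

lemma qnorm2_eq_0_iff: "qnorm2 q = 0 \<longleftrightarrow> qre q = 0 \<and> qim1 q = 0 \<and> qim2 q = 0 \<and> qim3 q = 0"
  by (simp add: qnorm2_def add_nonneg_eq_0_iff)

instantiation quat :: real_div_algebra
begin

definition zero_quat :: quat where "0 = Quat 0 0 0 0"

definition one_quat :: quat where "1 = Quat 1 0 0 0"

definition plus_quat :: "quat \<Rightarrow> quat \<Rightarrow> quat" where
  "p + q = Quat (qre p + qre q) (qim1 p + qim1 q) (qim2 p + qim2 q) (qim3 p + qim3 q)"

definition minus_quat :: "quat \<Rightarrow> quat \<Rightarrow> quat" where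
  "p - q = Quat (qre p - qre q) (qim1 p - qim1 q) (qim2 p - qim2 q) (qim3 p - qim3 q)"

definition uminus_quat :: "quat \<Rightarrow> quat" where
  "- q = Quat (- qre q) (- qim1 q) (- qim2 q) (- qim3 q)"

definition times_quat :: "quat \<Rightarrow> quat \<Rightarrow> quat" where
  "p * q = Quat
     (qre p * qre q - qim1 p * qim1 q - qim2 p * qim2 q - qim3 p * qim3 q)
     (qre p * qim1 q + qim1 p * qre q + qim2 p * qim3 q - qim3 p * qim2 q)
     (qre p * qim2 q - qim1 p * qim3 q + qim2 p * qre q + qim3 p * qim1 q)
     (qre p * qim3 q + qim1 p * qim2 q - qim2 p * qim1 q + qim3 p * qre q)"

definition scaleR_quat :: "real \<Rightarrow> quat \<Rightarrow> quat" where
  "r *\<^sub>R q = Quat (r * qre q) (r * qim1 q) (r * qim2 q) (r * qim3 q)"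

definition inverse_quat :: "quat \<Rightarrow> quat" where
  "inverse q = (1 / qnorm2 q) *\<^sub>R qcnj q"

definition divide_quat :: "quat \<Rightarrow> quat \<Rightarrow> quat" where
  "p div q = p * inverse q" for p q :: quat

instance
proof
  fix p q r :: quat and a b :: real
  note defs = zero_quat_def one_quat_def plus_quat_def minus_quat_def uminus_quat_def
    times_quat_def scaleR_quat_def inverse_quat_def qcnj_def quat_eq_iff
  show "p + q + r = p + (q + r)" by (simp add: defs)
  show "p + q = q + p" by (simp add: defs)
  show "0 + p = p" by (simp add: defs)
  show "- p + p = 0" by (simp add: defs)
  show "p - q = p + - q" by (simp add: defs)
  show "p * q * r = p * (q * r)" by (simp add: defs algebra_simps)
  show "(p + q) * r = p * r + q * r" by (simp add: defs algebra_simps)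
  show "p * (q + r) = p * q + p * r" by (simp add: defs algebra_simps)
  show "1 * p = p" by (simp add: defs)
  show "p * 1 = p" by (simp add: defs)
  show "(0::quat) \<noteq> 1" by (simp add: defs)
  show "a *\<^sub>R (p + q) = a *\<^sub>R p + a *\<^sub>R q" by (simp add: defs algebra_simps)
  show "(a + b) *\<^sub>R p = a *\<^sub>R p + b *\<^sub>R p" by (simp add: defs algebra_simps)
  show "a *\<^sub>R b *\<^sub>R p = (a * b) *\<^sub>R p" by (simp add: defs)
  show "1 *\<^sub>R p = p" by (simp add: defs)
  show "a *\<^sub>R p * q = a *\<^sub>R (p * q)" by (simp add: defs algebra_simps)
  show "p * a *\<^sub>R q = a *\<^sub>R (p * q)" by (simp add: defs algebra_simps)
  show "inverse (0::quat) = 0" by (simp add: defs)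
  show "p div q = p * inverse q" by (rule divide_quat_def)
  assume "p \<noteq> 0"
  then have nz: "qnorm2 p \<noteq> 0" by (simp add: qnorm2_eq_0_iff defs)
  have "p * qcnj p = qnorm2 p *\<^sub>R 1" "qcnj p * p = qnorm2 p *\<^sub>R 1"
    by (simp_all add: defs qnorm2_def power2_eq_square)
  with nz show "inverse p * p = 1" "p * inverse p = 1"
    by (simp_all add: defs field_simps)
qed

end


section \<open>Quaternionic matrices\<close>

text \<open>
  Matrices are indexed by a finite linearly ordered type \<open>'n\<close>, in place of \<open>{1, ..., n}\<close>
  with its usual order; thus \<open>n\<close> is \<open>CARD('n)\<close>.
\<close>

definition conj_transpose :: "quat^'n^'m \<Rightarrow> quat^'m^'n" where
  "conj_transpose A = (\<chi> i j. qcnj (A $ j $ i))"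

definition hermitian :: "quat^'n^'n \<Rightarrow> bool" where
  "hermitian A \<longleftrightarrow> A = conj_transpose A"

definition replace_column :: "quat^'n^'m \<Rightarrow> 'n \<Rightarrow> quat^'m \<Rightarrow> quat^'n^'m" where
  "replace_column A j v = (\<chi> p q. if q = j then v $ p else A $ p $ q)"


section \<open>Column determinants\<close>

text \<open>
  The list of the rightmost entries of the cycles of \<open>\<tau>\<close>, in the order in which the cycles are
  written: the last cycle is the one containing \<open>j\<close>, and it ends with \<open>j\<close>; every other cycle
  (fixed points included) ends with its smallest element, and these elements increase from
  right to left. Here \<open>set (support \<tau> p)\<close> is the set of entries of the cycle through \<open>p\<close>.
\<close>

definition cycle_ends :: "'n::{finite,linorder} \<Rightarrow> ('n \<Rightarrow> 'n) \<Rightarrow> 'n list" where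
  "cycle_ends j \<tau> =
     rev (sorted_list_of_set {p. p \<notin> set (support \<tau> j) \<and> p = Min (set (support \<tau> p))}) @ [j]"

text \<open>
  A cycle \<open>(i\<^sub>l ... i\<^sub>1 p)\<close> with rightmost entry \<open>p\<close> maps each entry to the one on its right and
  \<open>p\<close> to \<open>i\<^sub>l\<close>. As \<open>support \<tau> p = [p, \<tau> p, \<tau> (\<tau> p), ...] = [p, i\<^sub>l, ..., i\<^sub>1]\<close>, the product below is
  \<open>a(p, i\<^sub>l) * ... * a(i\<^sub>2, i\<^sub>1) * a(i\<^sub>1, p)\<close>, multiplied from left to right.
\<close>

definition cycle_factor :: "quat^'n^'n \<Rightarrow> ('n \<Rightarrow> 'n) \<Rightarrow> 'n \<Rightarrow> quat" where
  "cycle_factor A \<tau> p = prod_list (map (\<lambda>q. A $ q $ \<tau> q) (support \<tau> p))"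

text \<open>The number \<open>r\<close> of cycles of \<open>\<tau>\<close> is \<open>length (cycle_ends j \<tau>)\<close>.\<close>

definition cdet :: "'n \<Rightarrow> quat^('n::{finite,linorder})^('n::{finite,linorder}) \<Rightarrow> quat" where
  "cdet j A = (\<Sum>\<tau> | \<tau> permutes (UNIV :: 'n set).
     (- 1) ^ (CARD('n) - length (cycle_ends j \<tau>)) *
     prod_list (map (cycle_factor A \<tau>) (cycle_ends j \<tau>)))"

text \<open>
  The common real value of all column determinants. It exists for every Hermitian matrix, and
  the definition is meant for these only; for other matrices the description may be void.
\<close>

definition hermitian_det :: "quat^('n::{finite,linorder})^('n::{finite,linorder}) \<Rightarrow> real" where
  "hermitian_det A = (THE d. \<forall>j. cdet j A = of_real d)"

end

theory Submission
  imports Defs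
begin

text \<open>
  A summand of \<open>cdet j A\<close> is a signed product over the cycles of a permutation. Sort the summands
  by the cycle through \<open>j\<close>. That cycle, read from \<open>j\<close>, is a list \<open>l\<close> without repetitions which
  starts at \<open>j\<close>, and what remains of the permutation is an arbitrary permutation of \<open>- set l\<close>;
  so \<open>cdet j A\<close> is a signed sum over such lists \<open>l\<close> of a factor \<open>principal_det A (- set l)\<close> for the
  other cycles times the product of the entries of \<open>A\<close> around the closed walk \<open>l\<close>
  (\<open>cdet_expansion\<close>). The quantity \<open>principal_det\<close> satisfies the same recursion, with the
  first cycle taken through the least index (\<open>principal_det_expansion\<close>). From here on, permutations
  no longer occur.

  Let \<open>A\<close> be Hermitian. Reversing a closed walk conjugates its product, so a sum of closed-walk
  products with real weights unaffected by reversal is real, and only real parts count. Real parts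
  do not change when the walk is rotated.
  By induction \<open>principal_det A S\<close> is therefore a real number \<open>minor A S\<close>, and its expansion is valid
  from any index \<open>s \<in> S\<close> instead of the least one (\<open>minor_expansion\<close>). In particular every column
  determinant of \<open>A\<close> equals \<open>minor A UNIV\<close>.

  Replacing column \<open>j\<close> by a vector \<open>v\<close> affects only the last, rightmost factor of the cycle through
  \<open>j\<close>. Thus \<open>cdet j (replace_column A j v)\<close> is the \<open>j\<close>th entry of \<open>adjugate A *v v\<close> for a matrix
  \<open>adjugate A\<close> that does not depend on \<open>v\<close>. When \<open>v\<close> is column \<open>k \<noteq> j\<close> of \<open>A\<close>, the summands
  are walks from \<open>j\<close> that end by stepping to \<open>k\<close>. A walk \<open>a\<close> that avoids \<open>k\<close>, together with a cycle \<open>b\<close>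
  through \<open>k\<close> in the expansion of \<open>minor A (- set a)\<close>, gives the same product as the walk \<open>a @ b\<close>,
  with the opposite sign; everything cancels (\<open>adjugate_column\<close>). Hence
  \<open>adjugate A ** A\<close> is the scalar matrix \<open>det A\<close>. Taking conjugate transposes gives a right inverse
  of \<open>A\<close> up to the same scalar, and Cramer's rule follows.
\<close>


section \<open>Products along simple paths\<close>

definition simple_paths :: "'a \<Rightarrow> 'a set \<Rightarrow> 'a list set" where
  "simple_paths s S = {l. l \<noteq> [] \<and> hd l = s \<and> distinct l \<and> set l \<subseteq> S}"

fun path_product :: "quat^'n^'n \<Rightarrow> 'n list \<Rightarrow> quat" where
  "path_product A (p # q # l) = A $ p $ q * path_product A (q # l)"
| "path_product A l = 1"

definition closed_product :: "quat^'n^'n \<Rightarrow> 'n list \<Rightarrow> quat" where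
  "closed_product A l = path_product A l * A $ last l $ hd l"

lemma finite_simple_paths: "finite S \<Longrightarrow> finite (simple_paths s S)"
  by (rule finite_subset[OF _ finite_subset_distinct[of S]]) (auto simp: simple_paths_def)

lemma path_product_map2:
  "l \<noteq> [] \<Longrightarrow> prod_list (map2 (\<lambda>p q. A $ p $ q) l (tl l @ [x])) = path_product A l * A $ last l $ x"
  by (induction A l rule: path_product.induct) (auto simp: mult.assoc)

lemma path_product_append:
  "a \<noteq> [] \<Longrightarrow> b \<noteq> [] \<Longrightarrow> path_product A (a @ b) = path_product A a * A $ last a $ hd b * path_product A b"
proof (induction A a rule: path_product.induct)
  case ("2_2" A p)
  then show ?case by (cases b) auto
qed (auto simp: mult.assoc)

lemma path_product_cong:
  "(\<And>p q. p \<in> set l \<Longrightarrow> q \<in> set (tl l) \<Longrightarrow> A $ p $ q = B $ p $ q) \<Longrightarrow> path_product A l = path_product B l"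
proof (induction l rule: induct_list012)
  case (3 p q l)
  have "path_product A (q # l) = path_product B (q # l)"
    by (rule 3(2)) (auto intro: 3(3))
  then show ?case using 3(3)[of p q] by simp
qed auto


section \<open>Separating one cycle of a permutation\<close>

text \<open>
  The cycle through \<open>p\<close> is determined by the values of the map on any invariant set containing \<open>p\<close>.
\<close>
lemma support_cong:
  assumes eq: "\<And>x. x \<in> B \<Longrightarrow> \<sigma> x = \<rho> x" and cl: "\<rho> ` B \<subseteq> B" and p: "p \<in> B"
  shows "support \<sigma> p = support \<rho> p"
proof -
  have it: "(\<sigma> ^^ i) p = (\<rho> ^^ i) p \<and> (\<rho> ^^ i) p \<in> B" for i
    using assms by (induction i) auto
  then have "least_power \<sigma> p = least_power \<rho> p" by (simp add: least_power_def)
  with it show ?thesis by simp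
qed

lemma support_cycle_of_list:
  assumes "distinct l" "l \<noteq> []"
  shows "support (cycle_of_list l) (hd l) = l"
proof -
  have it: "(cycle_of_list l ^^ i) (hd l) = l ! (i mod length l)" for i
  proof -
    have "(cycle_of_list l ^^ i) (hd l) = hd (rotate i l)"
      using assms by (simp flip: cyclic_rotation add: hd_map)
    then show ?thesis using assms by (simp add: hd_rotate_conv_nth)
  qed
  have "least_power (cycle_of_list l) (hd l) = length l"
    unfolding least_power_def
  proof (rule Least_equality)
    show "(cycle_of_list l ^^ length l) (hd l) = hd l \<and> 0 < length l"
      using it[of "length l"] assms by (simp add: hd_conv_nth)
    fix m assume m: "(cycle_of_list l ^^ m) (hd l) = hd l \<and> 0 < m"
    show "length l \<le> m"
    proof (rule ccontr)
      assume "\<not> length l \<le> m"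
      then have "l ! m = l ! 0" using m it[of m] assms by (simp add: hd_conv_nth)
      with assms m \<open>\<not> length l \<le> m\<close> show False by (simp add: nth_eq_iff_index_eq)
    qed
  qed
  then show ?thesis by (intro nth_equalityI) (simp_all add: it)
qed

lemma map2_self_map: "map2 f l (map g l) = map (\<lambda>x. f x (g x)) l"
  by (induction l) auto

text \<open>
  On the list of the entries of one cycle, \<open>\<sigma>\<close> acts as \<open>rotate1\<close>, so the factor of the
  cycle is the product around a closed walk and no longer refers to \<open>\<sigma>\<close>.
\<close>
lemma cycle_factor_closed_product:
  fixes A :: "quat^'n^'n"
  assumes "permutation \<sigma>"
  shows "cycle_factor A \<sigma> p = closed_product A (support \<sigma> p)"
proof -
  let ?l = "support \<sigma> p"
  have ne: "?l \<noteq> []" and hd: "hd ?l = p"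
    using least_power_of_permutation(2)[OF assms, of p] by (auto simp: hd_map hd_upt)
  have d: "distinct ?l" by (rule cycle_of_permutation[OF assms])
  have "map \<sigma> ?l = map (cycle_of_list ?l) ?l"
    using cycle_restrict[OF assms] by (intro map_cong) auto
  also have "\<dots> = rotate1 ?l" using cyclic_rotation[OF d, of 1] by simp
  also have "\<dots> = tl ?l @ [hd ?l]" using ne by (rule rotate1_hd_tl)
  finally have r: "map \<sigma> ?l = tl ?l @ [hd ?l]" .
  have "cycle_factor A \<sigma> p = prod_list (map2 (\<lambda>p q. A $ p $ q) ?l (map \<sigma> ?l))"
    unfolding cycle_factor_def by (simp only: map2_self_map)
  also have "\<dots> = closed_product A ?l"
    unfolding r closed_product_def by (rule path_product_map2[OF ne])
  finally show ?thesis .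
qed

lemma support_in_simple_paths:
  assumes "finite S" "\<sigma> permutes S" "s \<in> S"
  shows "support \<sigma> s \<in> simple_paths s S"
proof -
  have P: "permutation \<sigma>" using assms(1,2) by (auto simp: permutation_permutes)
  have "support \<sigma> s \<noteq> []" "hd (support \<sigma> s) = s"
    using least_power_of_permutation(2)[OF P, of s] by (auto simp: hd_map hd_upt)
  moreover have "(\<sigma> ^^ i) s \<in> S" for i
    using permutes_in_image[OF permutes_funpow[OF assms(2)]] assms(3) by blast
  ultimately show ?thesis
    using cycle_of_permutation[OF P, of s] by (auto simp: simple_paths_def)
qed

definition glue_cycle :: "'a list \<Rightarrow> ('a \<Rightarrow> 'a) \<Rightarrow> 'a \<Rightarrow> 'a" where
  "glue_cycle l \<rho> x = (if x \<in> set l then cycle_of_list l x else \<rho> x)"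

lemma glue_cycle_permutes:
  assumes l: "l \<in> simple_paths s S" and \<rho>: "\<rho> permutes S - set l"
  shows "glue_cycle l \<rho> permutes S"
proof -
  have "glue_cycle l \<rho> = cycle_of_list l \<circ> \<rho>"
  proof
    fix x
    show "glue_cycle l \<rho> x = (cycle_of_list l \<circ> \<rho>) x"
    proof (cases "x \<in> set l")
      case True
      then show ?thesis using permutes_not_in[OF \<rho>, of x] by (simp add: glue_cycle_def)
    next
      case False
      then have "\<rho> x \<notin> set l" using permutes_in_image[OF \<rho>, of x] permutes_not_in[OF \<rho>, of x] by (cases "x \<in> S") auto
      with False show ?thesis by (simp add: glue_cycle_def id_outside_supp)
    qed
  qed
  moreover have "cycle_of_list l permutes S"
    using l by (auto simp: simple_paths_def intro: permutes_subset[OF cycle_permutes])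
  ultimately show ?thesis
    using \<rho> by (auto intro!: permutes_compose intro: permutes_subset)
qed

lemma support_glue_cycle:
  assumes l: "l \<in> simple_paths s S" and \<rho>: "\<rho> permutes S - set l"
  shows "support (glue_cycle l \<rho>) s = l"
    and "p \<notin> set l \<Longrightarrow> support (glue_cycle l \<rho>) p = support \<rho> p"
proof -
  have "support (glue_cycle l \<rho>) s = support (cycle_of_list l) s"
    by (rule support_cong[where B = "set l"])
       (use l cycle_is_surj[of l] in \<open>auto simp: glue_cycle_def simple_paths_def\<close>)
  also have "\<dots> = l" using l support_cycle_of_list[of l] by (auto simp: simple_paths_def)
  finally show "support (glue_cycle l \<rho>) s = l" .
  assume "p \<notin> set l"
  moreover have "\<rho> x \<notin> set l" if "x \<notin> set l" for x
    using that permutes_in_image[OF \<rho>, of x] permutes_not_in[OF \<rho>, of x] by (cases "x \<in> S") auto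
  ultimately show "support (glue_cycle l \<rho>) p = support \<rho> p"
    by (intro support_cong[where B = "- set l"]) (auto simp: glue_cycle_def)
qed

lemma glue_cycle_support:
  assumes "finite S" "\<sigma> permutes S"
  shows "glue_cycle (support \<sigma> s) (\<lambda>x. if x \<in> S - set (support \<sigma> s) then \<sigma> x else x) = \<sigma>"
proof -
  have "permutation \<sigma>" using assms by (auto simp: permutation_permutes)
  from cycle_restrict[OF this] show ?thesis
    using permutes_not_in[OF assms(2)] by (auto simp: glue_cycle_def fun_eq_iff simp del: set_map)
qed

text \<open>
  Permutations of \<open>S\<close> correspond to pairs consisting of their cycle through \<open>s\<close>, read as a list from
  \<open>s\<close>, and a permutation of the indices outside it.
\<close>
lemma sum_permutes_by_cycle:
  fixes S :: "'a set"
  assumes S: "finite S" and s: "s \<in> S"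
  shows "(\<Sum>\<sigma> | \<sigma> permutes S. f \<sigma>) =
    (\<Sum>l\<in>simple_paths s S. \<Sum>\<rho> | \<rho> permutes S - set l. f (glue_cycle l \<rho>))"
proof -
  let ?rest = "\<lambda>\<sigma> x. if x \<in> S - set (support \<sigma> s) then \<sigma> x else x"
  have "(\<Sum>\<sigma> | \<sigma> permutes S. f \<sigma>) =
      (\<Sum>(l, \<rho>) \<in> (SIGMA l:simple_paths s S. {\<rho>. \<rho> permutes S - set l}). f (glue_cycle l \<rho>))"
  proof (rule sum.reindex_bij_witness[where i = "\<lambda>(l, \<rho>). glue_cycle l \<rho>"
        and j = "\<lambda>\<sigma>. (support \<sigma> s, ?rest \<sigma>)"], goal_cases)
    case (1 \<sigma>)
    then show ?case using glue_cycle_support[OF S, of \<sigma> s] by simp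
  next
    case (2 \<sigma>)
    then show ?case
      using support_in_simple_paths[OF S _ s, of \<sigma>] semidecomposition[of \<sigma> S s] S by auto
  next
    case (3 l\<rho>)
    obtain l \<rho> where l\<rho>: "l\<rho> = (l, \<rho>)" by (cases l\<rho>)
    have l: "l \<in> simple_paths s S" and \<rho>: "\<rho> permutes S - set l" using 3 l\<rho> by auto
    have "?rest (glue_cycle l \<rho>) = \<rho>"
      unfolding support_glue_cycle(1)[OF l \<rho>]
      using permutes_not_in[OF \<rho>] by (auto simp: fun_eq_iff glue_cycle_def)
    then show ?case unfolding l\<rho> prod.case support_glue_cycle(1)[OF l \<rho>] by simp
  next
    case (4 l\<rho>)
    then show ?case using glue_cycle_permutes by auto
  next
    case (5 \<sigma>)
    then show ?case using glue_cycle_support[OF S, of \<sigma> s] by simp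
  qed
  also have "\<dots> = (\<Sum>l\<in>simple_paths s S. \<Sum>\<rho> | \<rho> permutes S - set l. f (glue_cycle l \<rho>))"
    using S by (intro sum.Sigma[symmetric] ballI finite_simple_paths finite_permutations) auto
  finally show ?thesis .
qed


section \<open>Expansion of column determinants along a cycle\<close>

text \<open>
  A set of representatives of the cycles of a permutation of \<open>S\<close>, so that its cardinality is the
  number of cycles.
\<close>
definition cycle_minima :: "('n::{finite,linorder} \<Rightarrow> 'n) \<Rightarrow> 'n set \<Rightarrow> 'n set" where
  "cycle_minima \<sigma> S = {p \<in> S. p = Min (set (support \<sigma> p))}"

text \<open>
  The contribution to a column determinant of the cycles that avoid the distinguished column, when
  these cycles fill up \<open>S\<close>. All cycles are started at their minima; the factors follow the order
  convention of \<open>cdet\<close>, which matters as the entries do not commute.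
\<close>
definition principal_det :: "quat^('n::{finite,linorder})^('n::{finite,linorder}) \<Rightarrow> 'n set \<Rightarrow> quat" where
  "principal_det A S = (\<Sum>\<sigma> | \<sigma> permutes S. (- 1) ^ (card S - card (cycle_minima \<sigma> S)) *
     prod_list (map (cycle_factor A \<sigma>) (rev (sorted_list_of_set (cycle_minima \<sigma> S)))))"

text \<open>
  The summands on the left treat the cycle through \<open>s\<close> as \<open>cdet\<close> treats the cycle through its column:
  it comes last, and it is started at \<open>s\<close>. For \<open>S = UNIV\<close> the left-hand side is
  \<open>cdet s A\<close>, and for \<open>s = Min S\<close> it is \<open>principal_det A S\<close>. Gluing a cycle to \<open>\<rho>\<close> does not
  change the other cycles, so once the cycle through \<open>s\<close> is fixed the remaining factors form a
  summand of \<open>principal_det A (S - set l)\<close>.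
\<close>
lemma cycle_sum_expansion:
  fixes A :: "quat^('n::{finite,linorder})^('n::{finite,linorder})"
  assumes s: "s \<in> S"
  defines "M \<equiv> \<lambda>\<sigma>. {p \<in> S. p \<notin> set (support \<sigma> s) \<and> p = Min (set (support \<sigma> p))}"
  shows "(\<Sum>\<sigma> | \<sigma> permutes S. (- 1) ^ (card S - Suc (card (M \<sigma>))) *
       prod_list (map (cycle_factor A \<sigma>) (rev (sorted_list_of_set (M \<sigma>)) @ [s]))) =
    (\<Sum>l\<in>simple_paths s S.
       (- 1) ^ (length l - 1) * principal_det A (S - set l) * closed_product A l)"
proof -
  have S: "finite S" by simp
  show ?thesis
    unfolding sum_permutes_by_cycle[OF S s] principal_det_def sum_distrib_left sum_distrib_right
  proof (intro sum.cong refl, goal_cases)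
    case (1 l \<rho>)
    let ?\<sigma> = "glue_cycle l \<rho>" and ?R = "S - set l"
    let ?K = "cycle_minima \<rho> ?R"
    from 1 have l: "l \<in> simple_paths s S" and \<rho>: "\<rho> permutes ?R" by auto
    have P: "permutation ?\<sigma>" using glue_cycle_permutes[OF l \<rho>] S by (auto simp: permutation_permutes)
    have P\<rho>: "permutation \<rho>" using \<rho> by (auto simp: permutation_permutes)
    have supp: "support ?\<sigma> s = l" "\<And>p. p \<notin> set l \<Longrightarrow> support ?\<sigma> p = support \<rho> p"
      using support_glue_cycle[OF l \<rho>] by auto
    have M: "M ?\<sigma> = ?K"
      unfolding M_def cycle_minima_def supp(1)
    proof (rule Collect_cong)
      fix p
      show "(p \<in> S \<and> p \<notin> set l \<and> p = Min (set (support ?\<sigma> p))) =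
          (p \<in> S - set l \<and> p = Min (set (support \<rho> p)))"
        by (cases "p \<in> set l") (simp_all only: supp(2) Diff_iff simp_thms)
    qed
    have KR: "card ?K \<le> card ?R" by (intro card_mono) (auto simp: cycle_minima_def)
    have cl: "card (set l) = length l" "length l \<ge> 1" "card ?R = card S - length l" "length l \<le> card S"
      using l S by (auto simp: simple_paths_def distinct_card card_Diff_subset Suc_le_eq
          intro: order_trans[OF eq_refl card_mono[of S "set l"]])
    have e: "card S - Suc (card ?K) = (length l - 1) + (card ?R - card ?K)"
      using cl KR by simp
    have m: "map (cycle_factor A ?\<sigma>) (rev (sorted_list_of_set ?K)) =
        map (cycle_factor A \<rho>) (rev (sorted_list_of_set ?K))"
      using supp(2) by (intro map_cong refl)
        (auto simp: cycle_factor_closed_product[OF P] cycle_factor_closed_product[OF P\<rho>]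
          cycle_minima_def)
    have c: "cycle_factor A ?\<sigma> s = closed_product A l"
      by (simp only: cycle_factor_closed_product[OF P] supp(1))
    show ?case
      unfolding M e by (simp add: m c power_add mult.assoc del: rev_map)
  qed
qed

lemma cdet_expansion:
  "cdet j A = (\<Sum>l\<in>simple_paths j UNIV.
     (- 1) ^ (length l - 1) * principal_det A (- set l) * closed_product A l)"
  using cycle_sum_expansion[of j UNIV A]
  by (simp add: cdet_def cycle_ends_def Compl_eq_Diff_UNIV del: set_map)

lemma principal_det_empty [simp]: "principal_det A {} = 1"
  by (simp add: principal_det_def cycle_minima_def)

lemma sorted_list_of_set_insert_least:
  fixes s :: "'a::linorder"
  assumes "finite M" and less: "\<And>p. p \<in> M \<Longrightarrow> s < p"
  shows "sorted_list_of_set (insert s M) = s # sorted_list_of_set M"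
proof -
  have "Min (insert s M) = s" using assms by (intro Min_eqI) (auto intro: less_imp_le)
  moreover have "insert s M - {s} = M" using less by auto
  ultimately show ?thesis using sorted_list_of_set_nonempty[of "insert s M"] assms(1) by simp
qed

text \<open>
  The least index of \<open>S\<close> is the minimum of its own cycle, and that cycle is written last; so the
  order convention of \<open>principal_det\<close> singles out the cycle through \<open>Min S\<close> exactly as the column
  determinant singles out the cycle through its column.
\<close>
lemma principal_det_expansion:
  assumes "S \<noteq> {}"
  shows "principal_det A S = (\<Sum>l\<in>simple_paths (Min S) S.
     (- 1) ^ (length l - 1) * principal_det A (S - set l) * closed_product A l)"
proof -
  let ?s = "Min S"
  have s: "?s \<in> S" and le: "\<And>p. p \<in> S \<Longrightarrow> ?s \<le> p" using assms by auto
  show ?thesis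
    unfolding cycle_sum_expansion[OF s, symmetric] principal_det_def[of A S]
  proof (intro sum.cong refl, goal_cases)
    case (1 \<sigma>)
    then have \<sigma>: "\<sigma> permutes S" by simp
    let ?M = "{p \<in> S. p \<notin> set (support \<sigma> ?s) \<and> p = Min (set (support \<sigma> p))}"
    have P: "permutation \<sigma>" using \<sigma> by (auto simp: permutation_permutes)
    have sp: "support \<sigma> p \<in> simple_paths p S" if "p \<in> S" for p
      using support_in_simple_paths[OF _ \<sigma> that] by simp
    have in_own: "p \<in> set (support \<sigma> p)" if "p \<in> S" for p
      using sp[OF that] unfolding simple_paths_def by (metis (mono_tags) hd_in_set mem_Collect_eq)
    have min_s: "?s = Min (set (support \<sigma> ?s))"
      using in_own[OF s] sp[OF s] le unfolding simple_paths_def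
      by (intro Min_eqI[symmetric]) (auto simp del: set_map)
    have only: "p = ?s" if p: "p \<in> S" "p \<in> set (support \<sigma> ?s)" "p = Min (set (support \<sigma> p))" for p
    proof -
      have "?s \<in> set (support \<sigma> p)"
        using disjoint_support'[OF P, of p ?s] disjoint_support'[OF P, of ?s p] p(2) by blast
      then have "Min (set (support \<sigma> p)) \<le> ?s" by (intro Min_le) auto
      then have "p \<le> ?s" by (rule ord_eq_le_trans[OF p(3)])
      then show ?thesis using le[OF p(1)] by (rule order.antisym)
    qed
    have ins: "cycle_minima \<sigma> S = insert ?s ?M"
      unfolding cycle_minima_def using s min_s only by blast
    have notin: "?s \<notin> ?M" using in_own[OF s] by simp
    have "\<And>p. p \<in> ?M \<Longrightarrow> ?s < p"
      using notin le by (metis (no_types, lifting) mem_Collect_eq order_le_neq_trans)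
    then have "sorted_list_of_set (insert ?s ?M) = ?s # sorted_list_of_set ?M"
      by (intro sorted_list_of_set_insert_least) simp_all
    moreover have "card (insert ?s ?M) = Suc (card ?M)"
      using notin by (intro card_insert_disjoint) simp_all
    ultimately show ?case unfolding ins by (simp only: rev.simps)
  qed
qed

lemma principal_det_cong:
  fixes A B :: "quat^('n::{finite,linorder})^('n::{finite,linorder})"
  assumes "\<And>p q. p \<in> S \<Longrightarrow> q \<in> S \<Longrightarrow> A $ p $ q = B $ p $ q"
  shows "principal_det A S = principal_det B S"
proof -
  have "finite S" by simp
  then show ?thesis using assms
  proof (induction S rule: finite_psubset_induct)
    case (psubset S)
    show ?case
    proof (cases "S = {}")
      case False
      show ?thesis unfolding principal_det_expansion[OF False]
      proof (intro sum.cong refl)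
        fix l assume l: "l \<in> simple_paths (Min S) S"
        then have "S - set l \<subset> S" by (cases l) (auto simp: simple_paths_def)
        then have "principal_det A (S - set l) = principal_det B (S - set l)"
          by (rule psubset.IH) (auto intro: psubset.prems)
        moreover have "set l \<subseteq> S" "set (tl l) \<subseteq> S" "last l \<in> S" "hd l \<in> S"
          using l by (cases l; auto simp: simple_paths_def)+
        then have "closed_product A l = closed_product B l"
          unfolding closed_product_def
          by (intro arg_cong2[where f = "(*)"] path_product_cong psubset.prems) auto
        ultimately show "(- 1) ^ (length l - 1) * principal_det A (S - set l) * closed_product A l =
            (- 1) ^ (length l - 1) * principal_det B (S - set l) * closed_product B l" by simp
      qed
    qed simp
  qed
qed


section \<open>Cutting paths at an index\<close>

definition path_pairs :: "'a \<Rightarrow> 'a \<Rightarrow> 'a set \<Rightarrow> ('a list \<times> 'a list) set" where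
  "path_pairs s t S = {(a, b). a \<in> simple_paths s S \<and> b \<in> simple_paths t S \<and> set a \<inter> set b = {}}"

text \<open>
  A simple path through \<open>t\<close> is cut at \<open>t\<close> into a path that stops just before \<open>t\<close> and one that
  starts at \<open>t\<close>.
\<close>
lemma sum_simple_paths_split:
  assumes S: "finite S" and st: "s \<noteq> t"
  shows "(\<Sum>l\<in>simple_paths s S. f l) =
    (\<Sum>(a, b)\<in>path_pairs s t S. f (a @ b)) + (\<Sum>l\<in>simple_paths s (S - {t}). f l)"
proof -
  have "simple_paths s S = {l \<in> simple_paths s S. t \<in> set l} \<union> simple_paths s (S - {t})"
    by (auto simp: simple_paths_def)
  then have "(\<Sum>l\<in>simple_paths s S. f l) =
      (\<Sum>l\<in>{l \<in> simple_paths s S. t \<in> set l} \<union> simple_paths s (S - {t}). f l)"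
    by (rule sum.cong) simp
  also have "\<dots> =
      (\<Sum>l | l \<in> simple_paths s S \<and> t \<in> set l. f l) + (\<Sum>l\<in>simple_paths s (S - {t}). f l)"
    using finite_simple_paths[OF S, of s] finite_simple_paths[of "S - {t}" s] S
    by (intro sum.union_disjoint) (simp_all, auto simp: simple_paths_def)
  finally have "(\<Sum>l\<in>simple_paths s S. f l) = \<dots>" .
  moreover have "(\<Sum>l | l \<in> simple_paths s S \<and> t \<in> set l. f l) =
      (\<Sum>(a, b)\<in>path_pairs s t S. f (a @ b))"
  proof (rule sum.reindex_bij_witness[where i = "\<lambda>(a, b). a @ b"
        and j = "\<lambda>l. (takeWhile (\<lambda>x. x \<noteq> t) l, dropWhile (\<lambda>x. x \<noteq> t) l)"], goal_cases)
    case (2 l)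
    then have l: "l \<noteq> []" "hd l = s" "distinct l" "set l \<subseteq> S" "t \<in> set l"
      by (auto simp: simple_paths_def)
    let ?a = "takeWhile (\<lambda>x. x \<noteq> t) l" and ?b = "dropWhile (\<lambda>x. x \<noteq> t) l"
    have "?a \<noteq> []" "hd ?a = s" using l st by (cases l; simp)+
    moreover have "?b \<noteq> []" using l(5) by (auto simp: dropWhile_eq_Nil_conv)
    moreover have "hd ?b = t" using hd_dropWhile[of "\<lambda>x. x \<noteq> t" l] \<open>?b \<noteq> []\<close> by auto
    moreover have "distinct (?a @ ?b)" "set (?a @ ?b) \<subseteq> S" using l by simp_all
    ultimately show ?case unfolding distinct_append set_append
      by (simp add: path_pairs_def simple_paths_def del: takeWhile_dropWhile_id)
  next
    case (3 p)
    obtain a b where p: "p = (a, b)" by (cases p)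
    have ab: "a \<in> simple_paths s S" "b \<in> simple_paths t S" "set a \<inter> set b = {}"
      using 3 p by (auto simp: path_pairs_def)
    then have "t \<in> set b" by (auto simp: simple_paths_def)
    with ab have "\<forall>x\<in>set a. x \<noteq> t" by auto
    moreover obtain b' where "b = t # b'" using ab(2) by (cases b) (auto simp: simple_paths_def)
    ultimately show ?case using p by (simp add: takeWhile_append2 dropWhile_append2)
  next
    case (4 p)
    then show ?case by (auto simp: path_pairs_def simple_paths_def)
  qed auto
  ultimately show ?thesis by simp
qed

text \<open>
  Nested sums of this form arise when an expansion along paths that avoid \<open>t\<close> is followed by an
  expansion at \<open>t\<close> on the remaining indices. Being indexed by the same pairs as in
  \<open>sum_simple_paths_split\<close>, they can be combined term by term with the paths through \<open>t\<close>.
\<close>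
lemma sum_path_pairs:
  assumes S: "finite S" and st: "s \<noteq> t"
  shows "(\<Sum>a\<in>simple_paths s (S - {t}). \<Sum>b\<in>simple_paths t (S - set a). g a b) =
    (\<Sum>(a, b)\<in>path_pairs s t S. g a b)"
proof -
  have "path_pairs s t S = (SIGMA a:simple_paths s (S - {t}). simple_paths t (S - set a))"
    using hd_in_set by (fastforce simp: path_pairs_def simple_paths_def)
  then show ?thesis using S by (simp add: sum.Sigma finite_simple_paths)
qed

lemma sum_path_pairs_swap:
  "(\<Sum>(a, b)\<in>path_pairs s t S. g a b) = (\<Sum>(a, b)\<in>path_pairs t s S. g b a)"
  by (rule sum.reindex_bij_witness[where i = prod.swap and j = prod.swap])
    (auto simp: path_pairs_def)


section \<open>Conjugation and real parts of quaternions\<close>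

lemma of_real_quat: "of_real r = Quat r 0 0 0"
  by (simp add: of_real_def one_quat_def scaleR_quat_def)

lemma qcnj_mult: "qcnj (p * q) = qcnj q * qcnj p"
  by (simp add: qcnj_def times_quat_def quat_eq_iff algebra_simps)

lemma qcnj_add: "qcnj (p + q) = qcnj p + qcnj q"
  by (simp add: qcnj_def plus_quat_def quat_eq_iff)

lemma qcnj_of_real [simp]: "qcnj (of_real r) = of_real r"
  by (simp add: qcnj_def of_real_quat)

lemma qcnj_one [simp]: "qcnj 1 = 1"
  using qcnj_of_real[of 1] by simp

lemma qcnj_sum: "qcnj (\<Sum>x\<in>X. f x) = (\<Sum>x\<in>X. qcnj (f x))"
  using qcnj_of_real[of 0] by (induction X rule: infinite_finite_induct) (auto simp: qcnj_add)

lemma qcnj_eq_self: "qcnj q = q \<Longrightarrow> q = of_real (qre q)"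
  by (simp add: qcnj_def of_real_quat quat_eq_iff)

lemma qre_of_real [simp]: "qre (of_real r) = r"
  by (simp add: of_real_quat)

lemma qre_of_real_mult: "qre (of_real r * q) = r * qre q"
  by (simp add: of_real_quat times_quat_def)

lemma qre_sum: "qre (\<Sum>x\<in>X. f x) = (\<Sum>x\<in>X. qre (f x))"
  by (induction X rule: infinite_finite_induct) (auto simp: zero_quat_def plus_quat_def)

lemma qre_mult_commute: "qre (p * q) = qre (q * p)"
  by (simp add: times_quat_def)

lemma of_real_quat_commute: "of_real r * q = q * (of_real r :: quat)"
  by (simp add: of_real_def)

lemma of_real_pull_left: "of_real c * p * (of_real r * q) = of_real (c * r) * (p * q :: quat)"
  by (simp add: of_real_def)


section \<open>Principal minors of Hermitian matrices\<close>

lemma hermitian_entry: "hermitian A \<Longrightarrow> qcnj (A $ i $ j) = A $ j $ i"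
  unfolding hermitian_def conj_transpose_def by (metis vec_lambda_beta)

lemma path_product_rev:
  assumes "hermitian A"
  shows "path_product A (rev l) = qcnj (path_product A l)"
proof (induction l rule: induct_list012)
  case (3 p q l)
  have "path_product A (rev (p # q # l)) = path_product A (rev (q # l)) * A $ q $ p"
    using path_product_append[of "rev (q # l)" "[p]" A] by simp
  then show ?case using 3 hermitian_entry[OF assms] by (simp add: qcnj_mult)
qed auto

text \<open>
  Reversing a closed walk while keeping its starting point conjugates its product: the factors occur
  in the opposite order, and each \<open>A $ p $ q\<close> becomes \<open>A $ q $ p\<close>.
\<close>
lemma closed_product_flip:
  assumes "hermitian A" "l \<noteq> []"
  shows "closed_product A (hd l # rev (tl l)) = qcnj (closed_product A l)"
proof (cases "tl l = []")
  case True
  with assms obtain s where "l = [s]" by (cases l) auto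
  then show ?thesis using hermitian_entry[OF assms(1)] by (simp add: closed_product_def)
next
  case False
  then obtain s m where l: "l = s # m" "m \<noteq> []" by (cases l) auto
  have e: "path_product A (s # m') = A $ s $ hd m' * path_product A m'" if "m' \<noteq> []" for m'
    using that by (cases m') auto
  show ?thesis using l
    by (simp add: e closed_product_def path_product_rev[OF assms(1)] qcnj_mult hermitian_entry[OF assms(1)]
        hd_rev last_rev mult.assoc)
qed

text \<open>
  Cutting a closed walk elsewhere multiplies the same two factors in the opposite order, and the real
  part of a product of two quaternions is symmetric in them.
\<close>
lemma closed_product_rotate:
  assumes "a \<noteq> []" "b \<noteq> []"
  shows "qre (closed_product A (a @ b)) = qre (closed_product A (b @ a))"
  using assms qre_mult_commute[of "path_product A a * A $ last a $ hd b"]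
  by (simp add: closed_product_def path_product_append mult.assoc)

text \<open>
  Reversal is a bijection on the closed walks from \<open>s\<close> and preserves the weights, so the sum is equal
  to its conjugate.
\<close>
lemma closed_product_sum_real:
  assumes "hermitian A"
    and w: "\<And>l m. set l = set m \<Longrightarrow> length l = length m \<Longrightarrow> w l = w m"
  shows "(\<Sum>l\<in>simple_paths s S. of_real (w l) * closed_product A l) =
    of_real (\<Sum>l\<in>simple_paths s S. w l * qre (closed_product A l))" (is "?X = of_real ?Y")
proof -
  let ?flip = "\<lambda>l. hd l # rev (tl l)"
  have flip: "set (?flip l) = set l" "length (?flip l) = length l" if "l \<noteq> []" for l :: "'a list"
    using that by (cases l; simp)+
  have "qcnj ?X = (\<Sum>l\<in>simple_paths s S. of_real (w l) * closed_product A (?flip l))"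
    unfolding qcnj_sum by (intro sum.cong refl)
      (auto simp: qcnj_mult of_real_quat_commute closed_product_flip[OF assms(1)] simple_paths_def)
  also have "\<dots> = ?X"
  proof (rule sum.reindex_bij_witness[where i = ?flip and j = ?flip], goal_cases)
    case (1 l)
    then show ?case by (cases l) (auto simp: simple_paths_def)
  next
    case (2 l)
    then show ?case by (cases l) (auto simp: simple_paths_def)
  next
    case (3 l)
    then show ?case by (cases l) (auto simp: simple_paths_def)
  next
    case (4 l)
    then show ?case by (cases l) (auto simp: simple_paths_def)
  next
    case (5 l)
    then have "l \<noteq> []" by (simp add: simple_paths_def)
    with w[OF flip] show ?case by simp
  qed
  finally have "?X = of_real (qre ?X)" by (rule qcnj_eq_self)
  then show ?thesis by (simp add: qre_sum qre_of_real_mult)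
qed

text \<open>
  For Hermitian \<open>A\<close> nothing is lost by taking the real part (\<open>principal_det_eq_minor\<close>).
\<close>
definition minor :: "quat^('n::{finite,linorder})^('n::{finite,linorder}) \<Rightarrow> 'n set \<Rightarrow> real" where
  "minor A S = qre (principal_det A S)"

definition cycle_weight :: "quat^'n^'n \<Rightarrow> 'n list \<Rightarrow> real" where
  "cycle_weight A l = (- 1) ^ (length l - 1) * qre (closed_product A l)"

text \<open>
  By induction the coefficients in the expansion at \<open>Min S\<close> are real, and then the whole
  sum over closed walks is real.
\<close>
lemma principal_det_eq_minor:
  fixes A :: "quat^('n::{finite,linorder})^('n::{finite,linorder})"
  assumes "hermitian A"
  shows "principal_det A S = of_real (minor A S)"
    and "S \<noteq> {} \<Longrightarrow> minor A S =
      (\<Sum>l\<in>simple_paths (Min S) S. cycle_weight A l * minor A (S - set l))"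
proof -
  have step: "principal_det A S = of_real
      (\<Sum>l\<in>simple_paths (Min S) S. cycle_weight A l * minor A (S - set l))"
    if "S \<noteq> {}" and IH: "\<And>R. R \<subset> S \<Longrightarrow> principal_det A R = of_real (minor A R)" for S
  proof -
    have "principal_det A S = (\<Sum>l\<in>simple_paths (Min S) S.
        of_real ((- 1) ^ (length l - 1) * minor A (S - set l)) * closed_product A l)"
      unfolding principal_det_expansion[OF that(1)]
    proof (intro sum.cong refl)
      fix l assume "l \<in> simple_paths (Min S) S"
      then have "S - set l \<subset> S" by (cases l) (auto simp: simple_paths_def)
      from IH[OF this] show "(- 1) ^ (length l - 1) * principal_det A (S - set l) * closed_product A l =
        of_real ((- 1) ^ (length l - 1) * minor A (S - set l)) * closed_product A l"
        by simp
    qed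
    also have "\<dots> = of_real (\<Sum>l\<in>simple_paths (Min S) S.
        (- 1) ^ (length l - 1) * minor A (S - set l) * qre (closed_product A l))"
      by (rule closed_product_sum_real[OF assms]) simp
    finally show ?thesis by (simp add: cycle_weight_def mult_ac)
  qed
  have real: "principal_det A S = of_real (minor A S)" for S
  proof -
    have "finite S" by simp
    then show ?thesis
    proof (induction S rule: finite_psubset_induct)
      case (psubset S)
      show ?case
      proof (cases "S = {}")
        case True
        then show ?thesis using qre_of_real[of 1] by (simp add: minor_def)
      next
        case False
        from step[OF False psubset.IH] show ?thesis by (simp only: minor_def qre_of_real)
      qed
    qed
  qed
  then show "principal_det A S = of_real (minor A S)" .
  show "minor A S = (\<Sum>l\<in>simple_paths (Min S) S. cycle_weight A l * minor A (S - set l))"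
    if "S \<noteq> {}"
    using step[OF that real] by (simp only: minor_def qre_of_real)
qed

text \<open>
  The expansions at two indices \<open>s\<close> and \<open>t\<close> agree. In the expansion at \<open>s\<close>, the cycles that avoid \<open>t\<close>
  are followed by an expansion of the smaller minor at \<open>t\<close>, and the cycles through \<open>t\<close> are cut at \<open>t\<close>.
  Both kinds of terms are then indexed by pairs of disjoint paths from \<open>s\<close> and from \<open>t\<close>, and their sum is
  symmetric in \<open>s\<close> and \<open>t\<close>.
\<close>
lemma minor_expansion:
  fixes A :: "quat^('n::{finite,linorder})^('n::{finite,linorder})"
  assumes A: "hermitian A" and "s \<in> S"
  shows "minor A S = (\<Sum>l\<in>simple_paths s S. cycle_weight A l * minor A (S - set l))"
proof -
  have "finite S" by simp
  then show ?thesis using \<open>s \<in> S\<close>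
  proof (induction S arbitrary: s rule: finite_psubset_induct)
    case (psubset S)
    let ?E = "\<lambda>s. \<Sum>l\<in>simple_paths s S. cycle_weight A l * minor A (S - set l)"
    \<comment> \<open>both kinds of terms, over pairs of disjoint paths\<close>
    have E: "?E s = (\<Sum>(a, b)\<in>path_pairs s t S.
        (cycle_weight A (a @ b) + cycle_weight A a * cycle_weight A b) * minor A (S - (set a \<union> set b)))"
      if st: "s \<noteq> t" and t: "t \<in> S" for s t
    proof -
      have "(\<Sum>l\<in>simple_paths s (S - {t}). cycle_weight A l * minor A (S - set l)) =
          (\<Sum>a\<in>simple_paths s (S - {t}). \<Sum>b\<in>simple_paths t (S - set a).
            cycle_weight A a * cycle_weight A b * minor A (S - (set a \<union> set b)))"
      proof (intro sum.cong refl)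
        fix a assume a: "a \<in> simple_paths s (S - {t})"
        then have "S - set a \<subset> S" "t \<in> S - set a" using t by (cases a; auto simp: simple_paths_def)+
        from psubset.IH[OF this] show "cycle_weight A a * minor A (S - set a) =
            (\<Sum>b\<in>simple_paths t (S - set a). cycle_weight A a * cycle_weight A b * minor A (S - (set a \<union> set b)))"
          by (simp add: sum_distrib_left mult.assoc Diff_eq Int_assoc Compl_Un)
      qed
      also have "\<dots> = (\<Sum>(a, b)\<in>path_pairs s t S.
          cycle_weight A a * cycle_weight A b * minor A (S - (set a \<union> set b)))"
        by (rule sum_path_pairs) (use st in auto)
      finally show ?thesis
        by (subst sum_simple_paths_split[OF _ st])
          (auto simp: sum.distrib[symmetric] distrib_right case_prod_unfold)
    qed
    have sym: "?E s = ?E t" if "s \<noteq> t" "s \<in> S" "t \<in> S" for s t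
      unfolding E[OF that(1,3)] E[OF that(1)[symmetric] that(2)]
    proof (subst sum_path_pairs_swap, intro sum.cong refl, goal_cases)
      case (1 p)
      obtain a b where p: "p = (a, b)" by (cases p)
      with 1 have "a \<noteq> []" "b \<noteq> []" by (auto simp: path_pairs_def simple_paths_def)
      from closed_product_rotate[OF this] have "cycle_weight A (b @ a) = cycle_weight A (a @ b)"
        by (simp add: cycle_weight_def add.commute)
      then show ?case unfolding p by (simp add: Un_commute mult_ac)
    qed
    have ne: "S \<noteq> {}" using psubset.prems by auto
    then have "Min S \<in> S" by simp
    have "minor A S = ?E (Min S)" by (rule principal_det_eq_minor(2)[OF A ne])
    also have "\<dots> = ?E s"
      using sym[OF _ \<open>Min S \<in> S\<close> psubset.prems] by (cases "Min S = s") (simp_all only: simp_thms)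
    finally show ?case .
  qed
qed

text \<open>
  The expansion with the full closed-walk products instead of their real parts: the imaginary
  parts cancel between a walk and its reversal. The cancellation in
  \<open>adjugate_column\<close> needs this form, because there these products are multiplied by products along
  paths that are not closed.
\<close>
lemma minor_quaternion_expansion:
  fixes A :: "quat^('n::{finite,linorder})^('n::{finite,linorder})"
  assumes A: "hermitian A" and s: "s \<in> S"
  shows "(\<Sum>l\<in>simple_paths s S. of_real ((- 1) ^ (length l - 1) * minor A (S - set l)) * closed_product A l) =
    of_real (minor A S)"
proof -
  have "minor A S = (\<Sum>l\<in>simple_paths s S. (- 1) ^ (length l - 1) * minor A (S - set l) * qre (closed_product A l))"
    unfolding minor_expansion[OF A s] cycle_weight_def by (simp add: mult_ac)
  then show ?thesis
    by (subst closed_product_sum_real[OF A]) simp_all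
qed


section \<open>The adjugate and Cramer's rule\<close>

definition path_cofactor :: "quat^('n::{finite,linorder})^('n::{finite,linorder}) \<Rightarrow> 'n list \<Rightarrow> quat" where
  "path_cofactor A l = of_real ((- 1) ^ (length l - 1) * minor A (- set l)) * path_product A l"

text \<open>
  The coefficients of \<open>v\<close> in \<open>cdet j (replace_column A j v)\<close>: the cycle through \<open>j\<close> enters column \<open>j\<close>
  from its last entry, so the coefficient of \<open>v $ i\<close> collects the paths from \<open>j\<close> to \<open>i\<close>.
\<close>
definition adjugate :: "quat^('n::{finite,linorder})^('n::{finite,linorder}) \<Rightarrow> quat^('n::{finite,linorder})^('n::{finite,linorder})" where
  "adjugate A = (\<chi> j i. \<Sum>l | l \<in> simple_paths j UNIV \<and> last l = i. path_cofactor A l)"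

lemma adjugate_mult_vec:
  "(adjugate A *v v) $ j = (\<Sum>l\<in>simple_paths j UNIV. path_cofactor A l * v $ last l)"
proof -
  have "(adjugate A *v v) $ j =
      (\<Sum>i\<in>UNIV. \<Sum>l | l \<in> simple_paths j UNIV \<and> last l = i. path_cofactor A l * v $ last l)"
    by (simp add: adjugate_def matrix_vector_mult_def sum_distrib_right)
  also have "\<dots> = (\<Sum>l\<in>simple_paths j UNIV. path_cofactor A l * v $ last l)"
    by (intro sum.group) (auto simp: finite_simple_paths)
  finally show ?thesis .
qed

text \<open>
  A simple path from \<open>j\<close> meets column \<open>j\<close> only when it is closed up, and the other cycles avoid this
  column altogether.
\<close>
lemma cdet_replace_column:
  fixes A :: "quat^('n::{finite,linorder})^('n::{finite,linorder})"
  assumes A: "hermitian A"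
  shows "cdet j (replace_column A j v) = (adjugate A *v v) $ j"
  unfolding cdet_expansion adjugate_mult_vec
proof (intro sum.cong refl)
  fix l assume l: "l \<in> simple_paths j UNIV"
  let ?B = "replace_column A j v"
  from l have j: "j \<in> set l" "j \<notin> set (tl l)" "hd l = j" by (cases l; auto simp: simple_paths_def)+
  have "principal_det ?B (- set l) = of_real (minor A (- set l))"
    unfolding principal_det_eq_minor(1)[OF A, symmetric]
    by (rule principal_det_cong) (use j in \<open>auto simp: replace_column_def\<close>)
  moreover have "path_product ?B l = path_product A l"
    by (rule path_product_cong) (use j in \<open>auto simp: replace_column_def\<close>)
  moreover have "?B $ last l $ j = v $ last l" by (simp add: replace_column_def)
  ultimately show "(- 1) ^ (length l - 1) * principal_det ?B (- set l) * closed_product ?B l =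
      path_cofactor A l * v $ last l"
    by (simp add: closed_product_def path_cofactor_def j mult.assoc)
qed

text \<open>
  For \<open>j = k\<close> this is the expansion of the determinant at \<open>j\<close>. For \<open>j \<noteq> k\<close> the paths \<open>a\<close> that avoid \<open>k\<close> are
  expanded further at \<open>k\<close>: running along \<open>a\<close>, stepping to \<open>k\<close> and going around a cycle \<open>b\<close> from \<open>k\<close>
  back to \<open>k\<close> passes the same entries as running along \<open>a @ b\<close> and stepping to \<open>k\<close>.
  Joining the two lists lowers the number of cycles by one, so the signs are opposite.
\<close>
lemma adjugate_column:
  fixes A :: "quat^('n::{finite,linorder})^('n::{finite,linorder})"
  assumes A: "hermitian A"
  shows "(adjugate A *v column k A) $ j = (if j = k then of_real (minor A UNIV) else 0)"
proof (cases "j = k")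
  case True
  have "(\<Sum>l\<in>simple_paths j UNIV. path_cofactor A l * A $ last l $ j) =
    (\<Sum>l\<in>simple_paths j UNIV. of_real ((- 1) ^ (length l - 1) * minor A (UNIV - set l)) * closed_product A l)"
    by (intro sum.cong refl)
      (auto simp: path_cofactor_def closed_product_def simple_paths_def mult.assoc Compl_eq_Diff_UNIV)
  with minor_quaternion_expansion[OF A, of j UNIV] True show ?thesis
    by (simp add: adjugate_mult_vec column_def)
next
  case False
  let ?f = "\<lambda>l. path_cofactor A l * A $ last l $ k"
  let ?g = "\<lambda>a b. of_real ((- 1) ^ (length a + length b) * minor A (- (set a \<union> set b))) *
      (path_product A a * A $ last a $ k * closed_product A b)"
  \<comment> \<open>paths that avoid \<open>k\<close>: the minors are real and can be moved past the path products\<close>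
  have "(\<Sum>l\<in>simple_paths j (UNIV - {k}). ?f l) =
      (\<Sum>a\<in>simple_paths j (UNIV - {k}). \<Sum>b\<in>simple_paths k (UNIV - set a). ?g a b)"
  proof (intro sum.cong refl)
    fix a assume a: "a \<in> simple_paths j (UNIV - {k})"
    then have k: "k \<in> UNIV - set a" and la: "length a > 0" by (auto simp: simple_paths_def)
    let ?P = "path_product A a * A $ last a $ k"
    have "?f a = of_real ((- 1) ^ (length a - 1)) * ?P * of_real (minor A (UNIV - set a))"
      by (simp add: path_cofactor_def mult.assoc Compl_eq_Diff_UNIV of_real_quat_commute[of "minor _ _"])
    also have "\<dots> = (\<Sum>b\<in>simple_paths k (UNIV - set a). of_real ((- 1) ^ (length a - 1)) * ?P *
        (of_real ((- 1) ^ (length b - 1) * minor A (UNIV - set a - set b)) * closed_product A b))"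
      unfolding minor_quaternion_expansion[OF A k, symmetric] sum_distrib_left ..
    also have "\<dots> = (\<Sum>b\<in>simple_paths k (UNIV - set a). ?g a b)"
    proof (intro sum.cong refl)
      fix b assume b: "b \<in> simple_paths k (UNIV - set a)"
      then have lb: "length b > 0" by (auto simp: simple_paths_def)
      have sgn: "(- 1) ^ (length a + length b) = (- 1 :: real) ^ (length a - 1) * (- 1) ^ (length b - 1)"
        using la lb by (cases a; cases b) (auto simp: power_add)
      have R: "UNIV - set a - set b = - (set a \<union> set b)" by auto
      show "of_real ((- 1) ^ (length a - 1)) * ?P *
          (of_real ((- 1) ^ (length b - 1) * minor A (UNIV - set a - set b)) * closed_product A b) = ?g a b"
        unfolding sgn R of_real_pull_left by (simp only: mult.assoc)
    qed
    finally show "?f a = (\<Sum>b\<in>simple_paths k (UNIV - set a). ?g a b)" .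
  qed
  also have "\<dots> = (\<Sum>(a, b)\<in>path_pairs j k UNIV. ?g a b)"
    by (rule sum_path_pairs) (use False in auto)
  finally have disj: "(\<Sum>l\<in>simple_paths j (UNIV - {k}). ?f l) = (\<Sum>(a, b)\<in>path_pairs j k UNIV. ?g a b)" .
  \<comment> \<open>paths through \<open>k\<close>\<close>
  have "?f (a @ b) = - ?g a b" if "(a, b) \<in> path_pairs j k UNIV" for a b
  proof -
    from that have ab: "a \<noteq> []" "b \<noteq> []" "hd b = k" by (auto simp: path_pairs_def simple_paths_def)
    then have sgn: "(- 1 :: real) ^ (length (a @ b) - 1) = - ((- 1) ^ (length a + length b))"
      by (cases a) auto
    show ?thesis
      unfolding path_cofactor_def sgn using ab
      by (simp add: path_product_append closed_product_def mult.assoc)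
  qed
  then have "(\<Sum>(a, b)\<in>path_pairs j k UNIV. ?f (a @ b)) = - (\<Sum>(a, b)\<in>path_pairs j k UNIV. ?g a b)"
    unfolding sum_negf[symmetric] by (intro sum.cong) auto
  with disj sum_simple_paths_split[of UNIV j k ?f] False show ?thesis
    by (simp add: adjugate_mult_vec column_def)
qed

lemma cdet_hermitian:
  fixes A :: "quat^('n::{finite,linorder})^('n::{finite,linorder})"
  assumes A: "hermitian A"
  shows "cdet j A = of_real (minor A UNIV)"
proof -
  have "replace_column A j (column j A) = A" by (auto simp: replace_column_def column_def vec_eq_iff)
  with cdet_replace_column[OF A, of j "column j A"] adjugate_column[OF A, of j j] show ?thesis by simp
qed

lemma hermitian_det_eq_minor:
  fixes A :: "quat^('n::{finite,linorder})^('n::{finite,linorder})"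
  assumes "hermitian A"
  shows "hermitian_det A = minor A UNIV"
  unfolding hermitian_det_def cdet_hermitian[OF assms] by (rule the_equality) auto

lemma adjugate_mult:
  fixes A :: "quat^('n::{finite,linorder})^('n::{finite,linorder})"
  assumes "hermitian A"
  shows "adjugate A ** A = mat (of_real (hermitian_det A))"
proof -
  have "(adjugate A ** A) $ j $ k = (adjugate A *v column k A) $ j" for j k
    by (simp add: matrix_matrix_mult_def matrix_vector_mult_def column_def)
  then show ?thesis
    by (simp add: vec_eq_iff mat_def adjugate_column[OF assms] hermitian_det_eq_minor[OF assms])
qed

lemma conj_transpose_mult: "conj_transpose (B ** C) = conj_transpose C ** conj_transpose B"
  by (simp add: conj_transpose_def matrix_matrix_mult_def vec_eq_iff qcnj_sum qcnj_mult)

lemma mult_conj_transpose_adjugate: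
  fixes A :: "quat^('n::{finite,linorder})^('n::{finite,linorder})"
  assumes "hermitian A"
  shows "A ** conj_transpose (adjugate A) = mat (of_real (hermitian_det A))"
proof -
  have "A ** conj_transpose (adjugate A) = conj_transpose (adjugate A ** A)"
    using assms by (simp add: conj_transpose_mult hermitian_def)
  also have "\<dots> = mat (of_real (hermitian_det A))"
    using qcnj_of_real[of 0] unfolding adjugate_mult[OF assms]
    by (simp add: conj_transpose_def mat_def vec_eq_iff)
  finally show ?thesis .
qed

lemma mat_of_real_mult_vec: "(mat (of_real d) *v v :: quat^'n) $ i = of_real d * v $ i"
  by (simp add: mat_def matrix_vector_mult_def if_distrib if_distribR sum.delta' cong: if_cong)

theorem theorem9p3:
  fixes A :: "quat^('n::{finite,linorder})^('n::{finite,linorder})" and x y :: "quat^('n::{finite,linorder})"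
  assumes "hermitian A" and "hermitian_det A \<noteq> 0"
  shows "A *v x = y \<longleftrightarrow>
    (\<forall>j. x $ j = cdet j (replace_column A j y) / of_real (hermitian_det A))"
proof -
  define d where "d = hermitian_det A"
  define L where "L = adjugate A"
  have d: "d \<noteq> 0" using assms(2) by (simp add: d_def)
  have LA: "L ** A = mat (of_real d)" and AL: "A ** conj_transpose L = mat (of_real d)"
    using adjugate_mult[OF assms(1)] mult_conj_transpose_adjugate[OF assms(1)]
    by (simp_all add: d_def L_def)
  have scale: "L *v (A *v v) = mat (of_real d) *v v" for v
    by (simp add: matrix_vector_mul_assoc LA)
  have cancel: "v = w" if "mat (of_real d) *v v = mat (of_real d) *v w" for v w :: "quat^('n::{finite,linorder})"
    using that d by (simp add: vec_eq_iff mat_of_real_mult_vec)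
  have rhs: "(\<forall>j. x $ j = cdet j (replace_column A j y) / of_real (hermitian_det A)) \<longleftrightarrow>
      mat (of_real d) *v x = L *v y"
    unfolding cdet_replace_column[OF assms(1)] vec_eq_iff mat_of_real_mult_vec
      d_def[symmetric] L_def[symmetric]
    using d by (simp add: nonzero_eq_divide_eq of_real_quat_commute)
  show ?thesis unfolding rhs
  proof
    assume "A *v x = y"
    then show "mat (of_real d) *v x = L *v y" using scale[of x] by simp
  next
    assume x: "mat (of_real d) *v x = L *v y"
    \<comment> \<open>the solution provided by the right inverse; it must be \<open>x\<close>\<close>
    define z where "z = conj_transpose L *v (\<chi> i. inverse (of_real d) * y $ i)"
    have "A *v z = y"
      using d by (simp add: z_def matrix_vector_mul_assoc AL vec_eq_iff mat_of_real_mult_vec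
          mult.assoc[symmetric])
    then have "mat (of_real d) *v z = L *v y" using scale[of z] by simp
    with x have "mat (of_real d) *v x = mat (of_real d) *v z" by (simp only:)
    then have "x = z" by (rule cancel)
    with \<open>A *v z = y\<close> show "A *v x = y" by simp
  qed
qed

end
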